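(* For any real numbers $0<a_1\le\dots\le a_n$, the contact form $\alpha_a$ on $S^{2n-1}$, $a=(a_1,\dots,a_n)$, is Hofer near-periodic.
   Context: Let $\lambda=\frac12\sum_{j=1}^n(x_j\,dy_j-y_j\,dx_j)$ be the standard Liouville form on $\mathbb C^n$ and let $f_a:S^{2n-1}\to\mathbb R$, $f_a(z_1,\dots,z_n)=\sum_i\frac{\pi}{a_i}|z_i|^2$. Then $\alpha_a:=f_a^{-1}\cdot\lambda|_{S^{2n-1}}$, a contact form for the standard contact structure on the unit sphere (with Reeb flow $(z_1,\dots,z_n)\mapsto(e^{2\pi it/a_1}z_1,\dots,e^{2\pi it/a_n}z_n)$, equivalent to the Reeb flow on the boundary of an ellipsoid). A contact form $\alpha$ on a contact manifold $(Y,\xi)$ is Hofer near-periodic if there exist contact forms $\alpha_i=\exp(f_i)\cdot\alpha$ on $(Y,\xi)$, with $f_i:Y\to\mathbb R$ smooth, such that the Reeb flow of $\alpha_i$ is $T_i$-periodic (i.e. its time $T_i$ map is the identity, with $T_i>0$ minimal) and $\|f_i\|_{C^0}\cdot T_i\to0$ as $i\to\infty$. *)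

theory Defs
  imports "HOL-Analysis.Analysis"
begin

section \<open>Smooth maps and embedded submanifolds of Euclidean space\<close>

text \<open>Manifolds are embedded submanifolds \<open>Y\<close> of a Euclidean space.\<close>

fun k_times_differentiable_on ::
  "nat \<Rightarrow> 'a::real_normed_vector set \<Rightarrow> ('a \<Rightarrow> 'b::real_normed_vector) \<Rightarrow> bool" where
  "k_times_differentiable_on 0 U f \<longleftrightarrow> continuous_on U f"
| "k_times_differentiable_on (Suc k) U f \<longleftrightarrow>
     (\<forall>x\<in>U. f differentiable (at x)) \<and>
     (\<forall>v. k_times_differentiable_on k U (\<lambda>x. frechet_derivative f (at x) v))"

text \<open>For \<open>U\<close> open in a finite-dimensional space, this is the usual notion of a map of class
  \<open>C\<^sup>\<infinity>\<close> on \<open>U\<close>.\<close>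

definition smooth_on :: "'a::real_normed_vector set \<Rightarrow> ('a \<Rightarrow> 'b::real_normed_vector) \<Rightarrow> bool" where
  "smooth_on U f \<longleftrightarrow> (\<forall>k. k_times_differentiable_on k U f)"

definition smooth_function :: "'a::euclidean_space set \<Rightarrow> ('a \<Rightarrow> real) \<Rightarrow> bool" where
  "smooth_function Y f \<longleftrightarrow>
     (\<forall>p\<in>Y. \<exists>U g. open U \<and> p \<in> U \<and> smooth_on U g \<and> (\<forall>x\<in>U \<inter> Y. g x = f x))"

definition embedded_submanifold :: "nat \<Rightarrow> 'a::euclidean_space set \<Rightarrow> bool" where
  "embedded_submanifold d Y \<longleftrightarrow>
     (\<forall>p\<in>Y. \<exists>U V \<phi> \<psi> (L::'a set).
        open U \<and> p \<in> U \<and> open V \<and> subspace L \<and> dim L = d \<and>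
        homeomorphism U V \<phi> \<psi> \<and> smooth_on U \<phi> \<and> smooth_on V \<psi> \<and>
        \<phi> ` (U \<inter> Y) = V \<inter> L)"

definition tangent_space :: "'a::euclidean_space set \<Rightarrow> 'a \<Rightarrow> 'a set" where
  "tangent_space Y p =
     {v. \<exists>\<gamma> e. 0 < e \<and> smooth_on {-e<..<e} \<gamma> \<and> \<gamma> ` {-e<..<e} \<subseteq> Y \<and> \<gamma> 0 = p \<and>
           (\<gamma> has_vector_derivative v) (at (0::real))}"

section \<open>Differential 1-forms\<close>

text \<open>A 1-form on \<open>Y\<close> is represented by a function \<open>\<alpha> p v\<close> of a base point and a vector; only the
  values for \<open>p \<in> Y\<close> and \<open>v\<close> tangent to \<open>Y\<close> at \<open>p\<close> are significant.\<close>

type_synonym 'a one_form = "'a \<Rightarrow> 'a \<Rightarrow> real"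

definition local_extension ::
  "'a::euclidean_space set \<Rightarrow> 'a one_form \<Rightarrow> 'a \<Rightarrow> 'a one_form \<Rightarrow> bool" where
  "local_extension Y \<alpha> p \<beta> \<longleftrightarrow>
     (\<exists>U. open U \<and> p \<in> U \<and> (\<forall>x\<in>U. linear (\<beta> x)) \<and> (\<forall>v. smooth_on U (\<lambda>x. \<beta> x v)) \<and>
          (\<forall>x\<in>U \<inter> Y. \<forall>v\<in>tangent_space Y x. \<beta> x v = \<alpha> x v))"

definition smooth_one_form :: "'a::euclidean_space set \<Rightarrow> 'a one_form \<Rightarrow> bool" where
  "smooth_one_form Y \<alpha> \<longleftrightarrow> (\<forall>p\<in>Y. \<exists>\<beta>. local_extension Y \<alpha> p \<beta>)"

text \<open>The exterior derivative of a smooth 1-form on \<open>Y\<close> is the restriction of that of a local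
  extension \<open>\<beta>\<close>, given by \<open>d\<beta>(u, v) = D\<^sub>u(\<beta>(v)) - D\<^sub>v(\<beta>(u))\<close> for constant vector fields \<open>u, v\<close>.
  Since the exterior derivative commutes with pullback to \<open>Y\<close>, its values on pairs of vectors
  tangent to \<open>Y\<close> do not depend on the extension chosen.\<close>

definition ext_deriv :: "'a::euclidean_space set \<Rightarrow> 'a one_form \<Rightarrow> 'a \<Rightarrow> 'a \<Rightarrow> 'a \<Rightarrow> real" where
  "ext_deriv Y \<alpha> p u v =
     (let \<beta> = (SOME \<beta>. local_extension Y \<alpha> p \<beta>)
      in frechet_derivative (\<lambda>x. \<beta> x v) (at p) u - frechet_derivative (\<lambda>x. \<beta> x u) (at p) v)"

section \<open>Contact forms and Reeb flows\<close>

text \<open>\<open>contact_form Y \<xi> \<alpha>\<close>: \<open>\<alpha>\<close> is a contact form on \<open>Y\<close> with kernel \<open>\<xi>\<close>, i.e. a nowhere vanishing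
  1-form with \<open>ker \<alpha> = \<xi>\<close> whose exterior derivative is nondegenerate on \<open>\<xi>\<close>. In particular
  \<open>(Y, \<xi>)\<close> is then a contact manifold, and \<open>\<alpha>\<close> is a contact form on it. Nondegeneracy forces
  \<open>\<xi>\<close> to have even rank, so a nonempty \<open>Y\<close> has odd dimension.\<close>

definition contact_form ::
  "'a::euclidean_space set \<Rightarrow> ('a \<Rightarrow> 'a set) \<Rightarrow> 'a one_form \<Rightarrow> bool" where
  "contact_form Y \<xi> \<alpha> \<longleftrightarrow>
     (\<exists>d. embedded_submanifold d Y) \<and> smooth_one_form Y \<alpha> \<and>
     (\<forall>p\<in>Y. (\<exists>v\<in>tangent_space Y p. \<alpha> p v \<noteq> 0) \<and>
            \<xi> p = {v \<in> tangent_space Y p. \<alpha> p v = 0} \<and>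
            (\<forall>u\<in>\<xi> p. (\<forall>v\<in>\<xi> p. ext_deriv Y \<alpha> p u v = 0) \<longrightarrow> u = 0))"

definition reeb_field :: "'a::euclidean_space set \<Rightarrow> 'a one_form \<Rightarrow> 'a \<Rightarrow> 'a" where
  "reeb_field Y \<alpha> p =
     (THE R. R \<in> tangent_space Y p \<and> \<alpha> p R = 1 \<and>
             (\<forall>v\<in>tangent_space Y p. ext_deriv Y \<alpha> p R v = 0))"

definition reeb_flow ::
  "'a::euclidean_space set \<Rightarrow> 'a one_form \<Rightarrow> (real \<Rightarrow> 'a \<Rightarrow> 'a) \<Rightarrow> bool" where
  "reeb_flow Y \<alpha> \<Phi> \<longleftrightarrow>
     (\<forall>p\<in>Y. \<Phi> 0 p = p \<and>
       (\<forall>t. \<Phi> t p \<in> Y \<and>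
            ((\<lambda>s. \<Phi> s p) has_vector_derivative reeb_field Y \<alpha> (\<Phi> t p)) (at t)))"

definition periodic_flow :: "'a set \<Rightarrow> (real \<Rightarrow> 'a \<Rightarrow> 'a) \<Rightarrow> real \<Rightarrow> bool" where
  "periodic_flow Y \<Phi> T \<longleftrightarrow>
     0 < T \<and> (\<forall>p\<in>Y. \<Phi> T p = p) \<and> (\<forall>t. 0 < t \<and> t < T \<longrightarrow> (\<exists>p\<in>Y. \<Phi> t p \<noteq> p))"

text \<open>The boundedness condition ensures that the real supremum below is the \<open>C\<^sup>0\<close>-norm of
  \<open>f i\<close>; it is automatic if \<open>Y\<close> is compact.\<close>

definition Hofer_near_periodic ::
  "'a::euclidean_space set \<Rightarrow> ('a \<Rightarrow> 'a set) \<Rightarrow> 'a one_form \<Rightarrow> bool" where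
  "Hofer_near_periodic Y \<xi> \<alpha> \<longleftrightarrow>
     contact_form Y \<xi> \<alpha> \<and>
     (\<exists>(f :: nat \<Rightarrow> 'a \<Rightarrow> real) (T :: nat \<Rightarrow> real).
        (\<forall>i. smooth_function Y (f i) \<and> bounded (f i ` Y) \<and>
             contact_form Y \<xi> (\<lambda>p v. exp (f i p) * \<alpha> p v) \<and>
             (\<exists>\<Phi>. reeb_flow Y (\<lambda>p v. exp (f i p) * \<alpha> p v) \<Phi> \<and> periodic_flow Y \<Phi> (T i))) \<and>
        (\<lambda>i. (SUP p\<in>Y. \<bar>f i p\<bar>) * T i) \<longlonglongrightarrow> 0)"

section \<open>The ellipsoid contact forms on the unit sphere\<close>

text \<open>With \<open>z\<^sub>j = x\<^sub>j + i y\<^sub>j\<close>, this is \<open>\<lambda> = 1/2 \<Sum>\<^sub>j (x\<^sub>j dy\<^sub>j - y\<^sub>j dx\<^sub>j)\<close>.\<close>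

definition liouville :: "(complex ^ 'n::finite) one_form" where
  "liouville z v = (1 / 2) * (\<Sum>j\<in>UNIV. Re (z $ j) * Im (v $ j) - Im (z $ j) * Re (v $ j))"

definition std_contact_structure :: "complex ^ 'n::finite \<Rightarrow> (complex ^ 'n) set" where
  "std_contact_structure z = {v \<in> tangent_space (sphere 0 1) z. liouville z v = 0}"

definition ellipsoid_fun :: "real ^ 'n::finite \<Rightarrow> complex ^ 'n \<Rightarrow> real" where
  "ellipsoid_fun a z = (\<Sum>j\<in>UNIV. pi / a $ j * (cmod (z $ j))\<^sup>2)"

definition ellipsoid_form :: "real ^ 'n::finite \<Rightarrow> (complex ^ 'n) one_form" where
  "ellipsoid_form a z v = inverse (ellipsoid_fun a z) * liouville z v"

end

theory Submission
  imports Defs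
begin

text \<open>If \<open>b\<close> is such that all \<open>T / b\<^sub>j\<close> are integers, then the Reeb flow of \<open>\<alpha>\<^sub>b\<close> is periodic with
  minimal period at most \<open>T\<close>, and \<open>\<alpha>\<^sub>b = exp(f) \<alpha>\<^sub>a\<close> with \<open>f = ln (f\<^sub>a / f\<^sub>b)\<close>, so that
  \<open>\<bar>f\<bar> \<le> max\<^sub>j \<bar>ln (a\<^sub>j / b\<^sub>j)\<bar>\<close>. Dirichlet's simultaneous approximation theorem gives arbitrarily
  small \<open>\<epsilon>\<close> and some \<open>T\<close>, bounded below, such that every \<open>T / a\<^sub>j\<close> is within \<open>\<epsilon>\<close> of a positive
  integer \<open>k\<^sub>j\<close>. For \<open>b\<^sub>j = T / k\<^sub>j\<close> the norm of \<open>f\<close> is then \<open>O(\<epsilon> / T)\<close>.\<close>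

section \<open>Calculus of smooth maps\<close>

text \<open>On an open set the derivative at a point depends only on nearby values, so the
  directional derivatives of \<open>f\<close> and \<open>g\<close> agree on \<open>U\<close> and the
  induction passes to them.\<close>

lemma k_times_differentiable_on_cong:
  fixes f g :: "'a::real_normed_vector \<Rightarrow> 'b::real_normed_vector"
  assumes "open U" "\<And>x. x \<in> U \<Longrightarrow> f x = g x" "k_times_differentiable_on k U f"
  shows "k_times_differentiable_on k U g"
  using assms(2,3)
proof (induction k arbitrary: f g)
  case 0
  then show ?case by (simp cong: continuous_on_cong)
next
  case (Suc k)
  have g: "(g has_derivative frechet_derivative f (at x)) (at x)" if "x \<in> U" for x
  proof -
    have "(f has_derivative frechet_derivative f (at x)) (at x)"
      using Suc.prems(2) that by (simp add: frechet_derivative_works[symmetric])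
    then show ?thesis
      by (rule has_derivative_transform_within_open[OF _ assms(1) that Suc.prems(1)])
  qed
  have fd: "frechet_derivative f (at x) v = frechet_derivative g (at x) v" if "x \<in> U" for x v
    by (simp only: frechet_derivative_at[OF g[OF that]])
  have "k_times_differentiable_on k U (\<lambda>x. frechet_derivative f (at x) v)" for v
    using Suc.prems(2) by simp
  then have "k_times_differentiable_on k U (\<lambda>x. frechet_derivative g (at x) v)" for v
    by (rule Suc.IH[rotated]) (rule fd)
  then show ?case
    using g by (auto simp: differentiable_def)
qed

text \<open>Lets an explicit derivative \<open>f'\<close> stand in for
  \<open>frechet_derivative\<close>; the two agree on \<open>U\<close> by uniqueness of
  derivatives.\<close>

lemma k_times_differentiable_on_SucI:
  fixes f :: "'a::real_normed_vector \<Rightarrow> 'b::real_normed_vector"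
  assumes "open U" "\<And>x. x \<in> U \<Longrightarrow> (f has_derivative f' x) (at x)"
    and "\<And>v. k_times_differentiable_on k U (\<lambda>x. f' x v)"
  shows "k_times_differentiable_on (Suc k) U f"
proof -
  have "k_times_differentiable_on k U (\<lambda>x. frechet_derivative f (at x) v)" for v
    by (rule k_times_differentiable_on_cong[OF assms(1) _ assms(3)])
      (simp only: frechet_derivative_at[OF assms(2)])
  then show ?thesis
    using assms(2) by (auto simp: differentiable_def)
qed

lemma k_times_differentiable_on_has_derivative:
  "k_times_differentiable_on (Suc k) U f \<Longrightarrow> x \<in> U \<Longrightarrow>
    (f has_derivative frechet_derivative f (at x)) (at x)"
  by (simp add: frechet_derivative_works[symmetric])

lemma k_times_differentiable_on_Suc_imp:
  "k_times_differentiable_on (Suc k) U f \<Longrightarrow> k_times_differentiable_on k U f"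
proof (induction k arbitrary: f)
  case 0
  then show ?case
    by (auto intro!: continuous_at_imp_continuous_on differentiable_imp_continuous_within)
next
  case (Suc k)
  then show ?case
    unfolding k_times_differentiable_on.simps(2)[of "Suc k"] k_times_differentiable_on.simps(2)[of k U f]
    by blast
qed

lemma k_times_differentiable_on_const: "k_times_differentiable_on k U (\<lambda>x. c)"
  by (induction k arbitrary: c) auto

lemma k_times_differentiable_on_linear:
  assumes "open U" "bounded_linear f"
  shows "k_times_differentiable_on k U f"
proof (cases k)
  case 0
  then show ?thesis using assms by (simp add: linear_continuous_on)
next
  case (Suc m)
  then show ?thesis
    unfolding Suc
    by (intro k_times_differentiable_on_SucI[where f' = "\<lambda>_. f"] assms
        bounded_linear_imp_has_derivative k_times_differentiable_on_const)
qed

lemma k_times_differentiable_on_add: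
  fixes f g :: "'a::real_normed_vector \<Rightarrow> 'b::real_normed_vector"
  assumes "open U" "k_times_differentiable_on k U f" "k_times_differentiable_on k U g"
  shows "k_times_differentiable_on k U (\<lambda>x. f x + g x)"
  using assms(2,3)
proof (induction k arbitrary: f g)
  case 0
  then show ?case by (simp add: continuous_on_add)
next
  case (Suc k)
  show ?case
    by (rule k_times_differentiable_on_SucI[OF assms(1)
          has_derivative_add[OF k_times_differentiable_on_has_derivative k_times_differentiable_on_has_derivative]])
      (use Suc in auto)
qed

text \<open>The product rule. Its two terms pair one map with a derivative of the other, so the
  induction must range over both maps.\<close>

lemma k_times_differentiable_on_bilinear:
  fixes f :: "'a::real_normed_vector \<Rightarrow> 'b::real_normed_vector"
    and g :: "'a \<Rightarrow> 'c::real_normed_vector"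
    and B :: "'b \<Rightarrow> 'c \<Rightarrow> 'd::real_normed_vector"
  assumes B: "bounded_bilinear B" and "open U"
    and "k_times_differentiable_on k U f" "k_times_differentiable_on k U g"
  shows "k_times_differentiable_on k U (\<lambda>x. B (f x) (g x))"
  using assms(3,4)
proof (induction k arbitrary: f g)
  case 0
  then show ?case
    by (simp add: bounded_bilinear.continuous_on[OF B])
next
  case (Suc k)
  note fg = Suc.prems[THEN k_times_differentiable_on_Suc_imp]
  have "k_times_differentiable_on k U (\<lambda>x. frechet_derivative f (at x) v)"
    "k_times_differentiable_on k U (\<lambda>x. frechet_derivative g (at x) v)" for v
    using Suc.prems by simp_all
  with fg have "k_times_differentiable_on k U
      (\<lambda>x. B (f x) (frechet_derivative g (at x) v) + B (frechet_derivative f (at x) v) (g x))" for v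
    by (intro k_times_differentiable_on_add Suc.IH assms(2))
  from k_times_differentiable_on_SucI[OF assms(2) bounded_bilinear.FDERIV[OF B
        k_times_differentiable_on_has_derivative[OF Suc.prems(1)]
        k_times_differentiable_on_has_derivative[OF Suc.prems(2)]] this]
  show ?case .
qed

text \<open>The derivative of \<open>1 / f\<close> is built from \<open>1 / f\<close> itself and the
  derivative of \<open>f\<close>, so regularity one order lower is enough and \<open>f\<close> stays
  fixed in the induction.\<close>

lemma k_times_differentiable_on_inverse:
  fixes f :: "'a::real_normed_vector \<Rightarrow> real"
  assumes "open U" "\<And>x. x \<in> U \<Longrightarrow> f x \<noteq> 0" "k_times_differentiable_on k U f"
  shows "k_times_differentiable_on k U (\<lambda>x. inverse (f x))"
  using assms(3)
proof (induction k)
  case 0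
  then show ?case using assms(2) by (simp add: continuous_on_inverse)
next
  case (Suc k)
  have inv: "k_times_differentiable_on k U (\<lambda>x. inverse (f x))"
    by (rule Suc.IH[OF k_times_differentiable_on_Suc_imp[OF Suc.prems]])
  have "k_times_differentiable_on k U (\<lambda>x. frechet_derivative f (at x) v)" for v
    using Suc.prems by simp
  then have dinv: "k_times_differentiable_on k U
      (\<lambda>x. (-1) * (inverse (f x) * frechet_derivative f (at x) v * inverse (f x)))" for v
    by (intro k_times_differentiable_on_bilinear[OF bounded_bilinear_mult]
        k_times_differentiable_on_const inv assms(1))
  have "((\<lambda>x. inverse (f x)) has_derivative
      (\<lambda>v. (-1) * (inverse (f x) * frechet_derivative f (at x) v * inverse (f x)))) (at x)"
    if "x \<in> U" for x
    using Deriv.has_derivative_inverse[OF assms(2)[OF that]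
        k_times_differentiable_on_has_derivative[OF Suc.prems that]] by simp
  from k_times_differentiable_on_SucI[OF assms(1) this dinv] show ?case .
qed

lemma k_times_differentiable_on_ln:
  fixes f :: "'a::real_normed_vector \<Rightarrow> real"
  assumes "open U" "\<And>x. x \<in> U \<Longrightarrow> 0 < f x" "k_times_differentiable_on k U f"
  shows "k_times_differentiable_on k U (\<lambda>x. ln (f x))"
proof (cases k)
  case 0
  then show ?thesis
    using assms(2,3) by (force intro!: continuous_on_ln)
next
  case (Suc m)
  have inv: "k_times_differentiable_on m U (\<lambda>x. inverse (f x))"
    using assms(2) k_times_differentiable_on_Suc_imp[OF assms(3)[unfolded Suc]]
    by (intro k_times_differentiable_on_inverse assms(1)) force+
  have "k_times_differentiable_on m U (\<lambda>x. frechet_derivative f (at x) v)" for v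
    using assms(3) Suc by simp
  then have dinv: "k_times_differentiable_on m U (\<lambda>x. frechet_derivative f (at x) v * inverse (f x))" for v
    by (intro k_times_differentiable_on_bilinear[OF bounded_bilinear_mult] inv assms(1))
  have "((\<lambda>x. ln (f x)) has_derivative
      (\<lambda>v. frechet_derivative f (at x) v * inverse (f x))) (at x)" if "x \<in> U" for x
    using has_derivative_ln[OF assms(2)[OF that]
        k_times_differentiable_on_has_derivative[OF assms(3)[unfolded Suc] that]]
    by (simp add: mult.commute)
  from k_times_differentiable_on_SucI[OF assms(1) this dinv] show ?thesis
    unfolding Suc .
qed

lemma k_times_differentiable_on_subset:
  "k_times_differentiable_on k U f \<Longrightarrow> V \<subseteq> U \<Longrightarrow> k_times_differentiable_on k V f"
  by (induction k arbitrary: f) (auto intro: continuous_on_subset)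

section \<open>Closure properties of smooth maps\<close>

lemma smooth_on_const: "smooth_on U (\<lambda>x. c)"
  by (simp add: smooth_on_def k_times_differentiable_on_const)

lemma smooth_on_linear: "open U \<Longrightarrow> bounded_linear f \<Longrightarrow> smooth_on U f"
  by (simp add: smooth_on_def k_times_differentiable_on_linear)

lemma smooth_on_add:
  "open U \<Longrightarrow> smooth_on U f \<Longrightarrow> smooth_on U g \<Longrightarrow> smooth_on U (\<lambda>x. f x + g x)"
  by (simp add: smooth_on_def k_times_differentiable_on_add)

lemma smooth_on_bilinear:
  "bounded_bilinear B \<Longrightarrow> open U \<Longrightarrow> smooth_on U f \<Longrightarrow> smooth_on U g \<Longrightarrow>
    smooth_on U (\<lambda>x. B (f x) (g x))"
  by (simp add: smooth_on_def k_times_differentiable_on_bilinear)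

lemmas smooth_on_mult = smooth_on_bilinear[OF bounded_bilinear_mult]
lemmas smooth_on_scaleR = smooth_on_bilinear[OF bounded_bilinear_scaleR]
lemmas smooth_on_inner = smooth_on_bilinear[OF bounded_bilinear_inner]

lemma smooth_on_diff:
  assumes "open U" "smooth_on U f" "smooth_on U g"
  shows "smooth_on U (\<lambda>x. f x - g x)"
  using smooth_on_add[OF assms(1,2) smooth_on_scaleR[OF assms(1) smooth_on_const[of U "-1"] assms(3)]]
  by simp

lemma smooth_on_inverse:
  fixes f :: "'a::real_normed_vector \<Rightarrow> real"
  shows "open U \<Longrightarrow> (\<And>x. x \<in> U \<Longrightarrow> f x \<noteq> 0) \<Longrightarrow> smooth_on U f \<Longrightarrow>
    smooth_on U (\<lambda>x. inverse (f x))"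
  by (simp add: smooth_on_def k_times_differentiable_on_inverse)

lemma smooth_on_ln:
  fixes f :: "'a::real_normed_vector \<Rightarrow> real"
  shows "open U \<Longrightarrow> (\<And>x. x \<in> U \<Longrightarrow> 0 < f x) \<Longrightarrow> smooth_on U f \<Longrightarrow> smooth_on U (\<lambda>x. ln (f x))"
  by (simp add: smooth_on_def k_times_differentiable_on_ln)

lemma smooth_on_id: "open U \<Longrightarrow> smooth_on U (\<lambda>x. x)"
  by (simp add: smooth_on_linear bounded_linear_ident)

lemma smooth_on_imp_continuous_on: "smooth_on U f \<Longrightarrow> continuous_on U f"
  using k_times_differentiable_on.simps(1) unfolding smooth_on_def by blast

lemma smooth_on_has_derivative:
  "smooth_on U f \<Longrightarrow> x \<in> U \<Longrightarrow> (f has_derivative frechet_derivative f (at x)) (at x)"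
  using k_times_differentiable_on_has_derivative unfolding smooth_on_def by blast

section \<open>The unit sphere\<close>

text \<open>The inversion in the sphere of radius \<open>sqrt 2\<close> about \<open>- p\<close>, i.e. stereographic projection: it
  exchanges the unit sphere and the hyperplane orthogonal to \<open>p\<close>.\<close>

definition sphere_chart :: "'a::euclidean_space \<Rightarrow> 'a \<Rightarrow> 'a" where
  "sphere_chart p y = (2 * inverse ((y + p) \<bullet> (y + p))) *\<^sub>R (y + p) - p"

text \<open>In the coordinate \<open>w = y + p\<close> the map sends \<open>w\<close> to
  \<open>2 w / |w|^2\<close>, which is its own inverse away from \<open>0\<close>.\<close>

lemma sphere_chart_involution:
  assumes "y \<noteq> - p"
  shows "sphere_chart p y \<noteq> - p" "sphere_chart p (sphere_chart p y) = y"
proof -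
  have w: "y + p \<noteq> 0"
    using assms by (metis add.commute add_eq_0_iff)
  then show "sphere_chart p y \<noteq> - p"
    by (simp add: sphere_chart_def)
  define w where "w = y + p"
  have "sphere_chart p y + p = (2 * inverse (w \<bullet> w)) *\<^sub>R w"
    by (simp add: sphere_chart_def w_def)
  then have "sphere_chart p (sphere_chart p y) = w - p"
    using w unfolding sphere_chart_def[of p "sphere_chart p y"] w_def[symmetric] by simp
  then show "sphere_chart p (sphere_chart p y) = y"
    by (simp add: w_def)
qed

text \<open>Expanding the square with \<open>w = y + p\<close> gives
  \<open>1 + 4 (1 - w \<bullet> p) / |w|^2\<close>, and \<open>w \<bullet> p = 1\<close> says that
  \<open>y\<close> is orthogonal to \<open>p\<close>.\<close>

lemma norm_sphere_chart_eq_1_iff: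
  assumes "norm p = 1" "y \<noteq> - p"
  shows "norm (sphere_chart p y) = 1 \<longleftrightarrow> p \<bullet> y = 0"
proof -
  define w where "w = y + p"
  have "w \<noteq> 0"
    using assms(2) by (metis add.commute add_eq_0_iff w_def)
  then have w: "w \<bullet> w \<noteq> 0" by simp
  have p: "p \<bullet> p = 1" using assms(1) by (simp add: norm_eq_1)
  have "sphere_chart p y \<bullet> sphere_chart p y = 4 * inverse (w \<bullet> w) * (1 - w \<bullet> p) + 1"
    unfolding sphere_chart_def w_def[symmetric]
    using w p by (simp add: inner_diff_left inner_diff_right inner_commute[of p w] field_simps)
  moreover have "w \<bullet> p = y \<bullet> p + 1"
    by (simp add: w_def inner_add_left p)
  ultimately show ?thesis
    using w by (simp add: norm_eq_1 inner_commute)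
qed

lemma smooth_on_sphere_chart: "smooth_on (- {- p}) (sphere_chart p)"
proof -
  have "y + p \<noteq> 0" if "y \<in> - {- p}" for y
    using that by (metis ComplD add.commute add_eq_0_iff singletonI)
  then show ?thesis
    unfolding sphere_chart_def
    by (intro smooth_on_diff smooth_on_scaleR smooth_on_mult smooth_on_inverse smooth_on_inner
        smooth_on_add smooth_on_const smooth_on_id) auto
qed

lemma embedded_submanifold_sphere:
  "embedded_submanifold (DIM('a) - 1) (sphere (0::'a::euclidean_space) 1)"
  unfolding embedded_submanifold_def
proof
  fix p :: 'a assume "p \<in> sphere 0 1"
  then have p: "norm p = 1" by simp
  let ?U = "- {- p}" and ?L = "{y. p \<bullet> y = 0}"
  have "homeomorphism ?U ?U (sphere_chart p) (sphere_chart p)"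
  proof -
    have "continuous_on ?U (sphere_chart p)"
      by (rule smooth_on_imp_continuous_on[OF smooth_on_sphere_chart])
    moreover have "sphere_chart p ` ?U \<subseteq> ?U"
    proof (rule image_subsetI)
      fix y assume "y \<in> ?U"
      then have "y \<noteq> - p" by blast
      from sphere_chart_involution(1)[OF this] show "sphere_chart p y \<in> ?U" by blast
    qed
    moreover have "sphere_chart p (sphere_chart p y) = y" if "y \<in> ?U" for y
    proof -
      from that have "y \<noteq> - p" by blast
      then show ?thesis by (rule sphere_chart_involution(2))
    qed
    ultimately show ?thesis by (intro homeomorphismI)
  qed
  \<comment> \<open>Both inclusions use the same equivalence: as the chart is an involution, each
    point is the image of its own image.\<close>
  moreover have "sphere_chart p ` (?U \<inter> sphere 0 1) = ?U \<inter> ?L" (is "?A = ?B")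
  proof (intro equalityI subsetI)
    fix x assume "x \<in> ?A"
    then obtain y where x: "x = sphere_chart p y" and y: "y \<in> ?U \<inter> sphere 0 1" by (rule imageE)
    then have "y \<noteq> - p" "norm y = 1" by simp_all
    then have "x \<noteq> - p" "sphere_chart p x = y"
      unfolding x by (simp_all only: sphere_chart_involution not_False_eq_True)
    then show "x \<in> ?B"
      using norm_sphere_chart_eq_1_iff[OF p, of x] \<open>norm y = 1\<close> by simp
  next
    fix x assume "x \<in> ?B"
    then have x: "x \<noteq> - p" "p \<bullet> x = 0" by simp_all
    have "sphere_chart p x \<in> ?U \<inter> sphere 0 1"
      using norm_sphere_chart_eq_1_iff[OF p x(1)] sphere_chart_involution(1)[OF x(1)] x(2) by simp
    then show "x \<in> ?A"
      by (rule image_eqI[rotated]) (simp only: sphere_chart_involution(2)[OF x(1)])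
  qed
  moreover have "p \<noteq> 0"
    using p by auto
  moreover from this have "p \<noteq> - p"
    by (metis add_eq_0_iff scaleR_2 scaleR_eq_0_iff zero_neq_numeral)
  ultimately show "\<exists>U V \<phi> \<psi> (L::'a set). open U \<and> p \<in> U \<and> open V \<and> subspace L \<and>
      dim L = DIM('a) - 1 \<and> homeomorphism U V \<phi> \<psi> \<and> smooth_on U \<phi> \<and> smooth_on V \<psi> \<and>
      \<phi> ` (U \<inter> sphere 0 1) = V \<inter> L"
    by (intro exI[of _ ?U] exI[of _ "sphere_chart p"] exI[of _ ?L])
      (auto simp: subspace_hyperplane dim_hyperplane smooth_on_sphere_chart)
qed

section \<open>Tangent vectors to the sphere\<close>

lemma sphere_curve_exists:
  fixes p v :: "'a::euclidean_space"
  assumes "norm p = 1" "p \<bullet> v = 0"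
  obtains \<gamma> :: "real \<Rightarrow> 'a" where "smooth_on UNIV \<gamma>" "range \<gamma> \<subseteq> sphere 0 1" "\<gamma> 0 = p"
    "(\<gamma> has_vector_derivative v) (at 0)"
proof
  \<comment> \<open>This is \<open>sphere_chart p\<close> along the line
    \<open>(t / 2) *\<^sub>R v\<close> in the hyperplane orthogonal to \<open>p\<close>. The factor
    1/2 offsets the derivative of the chart at \<open>0\<close>, which doubles vectors orthogonal to
    \<open>p\<close>.\<close>
  let ?\<gamma> = "\<lambda>t. (2 * inverse (1 + t * t * (v \<bullet> v / 4))) *\<^sub>R (p + (t / 2) *\<^sub>R v) - p"
  have p: "p \<bullet> p = 1" using assms(1) by (simp add: norm_eq_1)
  have pos: "1 + t * t * (v \<bullet> v / 4) > 0" for t :: real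
    by (intro add_pos_nonneg) auto
  then have nz: "1 + t * t * (v \<bullet> v / 4) \<noteq> 0" for t :: real
    by (metis less_irrefl)
  have "bounded_linear (\<lambda>t::real. (t / 2) *\<^sub>R v)"
    by (intro bounded_linear_scaleR_left[THEN bounded_linear_compose] bounded_linear_divide)
  then show "smooth_on UNIV ?\<gamma>"
    by (intro smooth_on_diff smooth_on_scaleR smooth_on_mult smooth_on_inverse smooth_on_add
        smooth_on_const smooth_on_id smooth_on_linear nz) auto
  have "norm (?\<gamma> t) = 1" for t
  proof -
    let ?y = "(t / 2) *\<^sub>R v"
    have "(?y + p) \<bullet> (?y + p) = 1 + t * t * (v \<bullet> v / 4)"
      using p assms(2) by (simp add: inner_add_left inner_add_right inner_commute)
    then have "?\<gamma> t = sphere_chart p ?y"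
      by (simp add: sphere_chart_def add.commute)
    moreover have "p \<bullet> (- p) \<noteq> p \<bullet> ?y"
      using p assms(2) by simp
    then have "?y \<noteq> - p" by (intro notI) simp
    ultimately show ?thesis
      using norm_sphere_chart_eq_1_iff[OF assms(1), of ?y] assms(2) by auto
  qed
  then show "range ?\<gamma> \<subseteq> sphere 0 1" by auto
  show "?\<gamma> 0 = p" by (simp add: scaleR_2)
  show "(?\<gamma> has_vector_derivative v) (at 0)"
    unfolding has_vector_derivative_def
    by (rule has_derivative_eq_rhs, (rule derivative_intros | simp add: nz)+)
qed

text \<open>Differentiating \<open>\<gamma> t \<bullet> \<gamma> t = 1\<close> gives orthogonality;
  conversely every orthogonal vector is the velocity of an explicit curve.\<close>

lemma tangent_space_sphere:
  fixes p :: "'a::euclidean_space"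
  assumes "norm p = 1"
  shows "tangent_space (sphere 0 1) p = {v. p \<bullet> v = 0}"
proof (intro equalityI subsetI)
  fix v assume "v \<in> tangent_space (sphere 0 1) p"
  then obtain \<gamma> e where e: "0 < e" "\<gamma> ` {-e<..<e} \<subseteq> sphere 0 1" "\<gamma> 0 = p"
    and v: "(\<gamma> has_vector_derivative v) (at (0::real))"
    by (auto simp: tangent_space_def)
  have "((\<lambda>t. \<gamma> t \<bullet> \<gamma> t) has_vector_derivative (p \<bullet> v + v \<bullet> p)) (at 0)"
    using bounded_bilinear.has_vector_derivative[OF bounded_bilinear_inner v v] e(3) by simp
  moreover have "((\<lambda>t. \<gamma> t \<bullet> \<gamma> t) has_vector_derivative 0) (at 0)"
    by (rule has_vector_derivative_transform_within_open[of "\<lambda>_. 1" _ _ "{-e<..<e}"])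
      (use e in \<open>auto simp: norm_eq_1 image_subset_iff\<close>)
  ultimately show "v \<in> {v. p \<bullet> v = 0}"
    by (auto simp: inner_commute dest: vector_derivative_unique_at)
next
  fix v assume "v \<in> {v. p \<bullet> v = 0}"
  then obtain \<gamma> :: "real \<Rightarrow> 'a" where \<gamma>: "smooth_on UNIV \<gamma>" "range \<gamma> \<subseteq> sphere 0 1" "\<gamma> 0 = p"
    "(\<gamma> has_vector_derivative v) (at 0)"
    using sphere_curve_exists assms by blast
  moreover have "smooth_on {-1<..<1} \<gamma>"
    using \<gamma>(1) unfolding smooth_on_def by (meson k_times_differentiable_on_subset subset_UNIV)
  ultimately show "v \<in> tangent_space (sphere 0 1) p"
    unfolding tangent_space_def by (auto intro!: exI[of _ \<gamma>] exI[of _ "1::real"])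
qed

section \<open>Exterior derivatives on the sphere\<close>

text \<open>The difference \<open>\<delta>\<close> of two extensions vanishes on the tangent fields \<open>V\<^sub>v(x) = v - (x \<bullet> v) x\<close>.
  Differentiating \<open>\<delta>\<^sub>x(V\<^sub>v(x)) = 0\<close> at \<open>p\<close> in a tangent direction \<open>u\<close> gives
  \<open>D\<^sub>u(\<delta>(v)) = (u \<bullet> v) \<delta>\<^sub>p(p)\<close>, which is symmetric in \<open>u\<close> and \<open>v\<close>.\<close>

lemma local_extension_sphere_difference:
  fixes p u v :: "'a::euclidean_space"
  assumes \<beta>: "local_extension (sphere 0 1) \<alpha> p \<beta>" and \<beta>': "local_extension (sphere 0 1) \<alpha> p \<beta>'"
    and p: "norm p = 1" and u: "p \<bullet> u = 0" and v: "p \<bullet> v = 0"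
  shows "frechet_derivative (\<lambda>x. \<beta> x v) (at p) u - frechet_derivative (\<lambda>x. \<beta>' x v) (at p) u =
    (u \<bullet> v) * (\<beta> p p - \<beta>' p p)"
proof -
  obtain U where U: "open U" "p \<in> U" "\<And>x. x \<in> U \<Longrightarrow> linear (\<beta> x)" "\<And>v. smooth_on U (\<lambda>x. \<beta> x v)"
    and eq: "\<And>x v. x \<in> U \<Longrightarrow> norm x = 1 \<Longrightarrow> x \<bullet> v = 0 \<Longrightarrow> \<beta> x v = \<alpha> x v"
    using \<beta> by (auto simp: local_extension_def tangent_space_sphere)
  obtain U' where U': "open U'" "p \<in> U'" "\<And>x. x \<in> U' \<Longrightarrow> linear (\<beta>' x)" "\<And>v. smooth_on U' (\<lambda>x. \<beta>' x v)"
    and eq': "\<And>x v. x \<in> U' \<Longrightarrow> norm x = 1 \<Longrightarrow> x \<bullet> v = 0 \<Longrightarrow> \<beta>' x v = \<alpha> x v"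
    using \<beta>' by (auto simp: local_extension_def tangent_space_sphere)
  define \<delta> where "\<delta> x w = \<beta> x w - \<beta>' x w" for x w
  have lin: "linear (\<delta> x)" if "x \<in> U \<inter> U'" for x
    unfolding \<delta>_def using U(3) U'(3) that by (auto intro: linear_compose_sub)
  have der: "((\<lambda>x. \<delta> x w) has_derivative (\<lambda>h. frechet_derivative (\<lambda>x. \<beta> x w) (at p) h
      - frechet_derivative (\<lambda>x. \<beta>' x w) (at p) h)) (at p)" for w
    unfolding \<delta>_def
    by (intro has_derivative_diff smooth_on_has_derivative[OF U(4) U(2)]
        smooth_on_has_derivative[OF U'(4) U'(2)])
  obtain \<gamma> :: "real \<Rightarrow> 'a" where \<gamma>: "range \<gamma> \<subseteq> sphere 0 1" "\<gamma> 0 = p"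
    and \<gamma>': "(\<gamma> has_vector_derivative u) (at 0)"
    using sphere_curve_exists[OF p u] by metis
  have along: "((\<lambda>t. \<delta> (\<gamma> t) w) has_real_derivative (frechet_derivative (\<lambda>x. \<beta> x w) (at p) u
      - frechet_derivative (\<lambda>x. \<beta>' x w) (at p) u)) (at 0)" for w
  proof -
    have "((\<lambda>x. \<delta> x w) has_derivative (\<lambda>h. frechet_derivative (\<lambda>x. \<beta> x w) (at p) h
      - frechet_derivative (\<lambda>x. \<beta>' x w) (at p) h)) (at (\<gamma> 0))"
      using der[of w] by (simp add: \<gamma>(2))
    from vector_derivative_diff_chain_within[OF \<gamma>' has_derivative_at_withinI[OF this]]
    show ?thesis
      by (simp add: o_def has_real_derivative_iff_has_vector_derivative)
  qed
  \<comment> \<open>Near \<open>0\<close> this is \<open>\<delta> (\<gamma> t) (\<gamma> t)\<close>.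
    Expanding the second argument in the basis reduces its continuity to that of
    \<open>\<delta> (\<gamma> t) b\<close> for fixed \<open>b\<close>.\<close>
  define c where "c t = (\<Sum>b\<in>Basis. (\<gamma> t \<bullet> b) * \<delta> (\<gamma> t) b)" for t
  have c: "c t = \<delta> (\<gamma> t) (\<gamma> t)" if "\<gamma> t \<in> U \<inter> U'" for t
  proof -
    have "\<delta> (\<gamma> t) w = (\<Sum>b\<in>Basis. (w \<bullet> b) * \<delta> (\<gamma> t) b)" for w
    proof -
      have "\<delta> (\<gamma> t) w = \<delta> (\<gamma> t) (\<Sum>b\<in>Basis. (w \<bullet> b) *\<^sub>R b)"
        by (simp only: euclidean_representation)
      also have "\<dots> = (\<Sum>b\<in>Basis. (w \<bullet> b) * \<delta> (\<gamma> t) b)"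
        by (simp only: linear_sum[OF lin[OF that]] linear_scale[OF lin[OF that]] real_scaleR_def)
      finally show ?thesis .
    qed
    from this[symmetric] show ?thesis unfolding c_def .
  qed
  have cont: "isCont \<gamma> 0"
    using \<gamma>' has_vector_derivative_continuous by blast
  have "isCont c 0"
    unfolding c_def by (intro continuous_intros cont DERIV_isCont[OF along])
  have near: "\<forall>\<^sub>F t in nhds 0. \<gamma> t \<in> U \<inter> U'"
  proof (rule topological_tendstoD)
    show "(\<gamma> \<longlongrightarrow> \<gamma> 0) (nhds 0)"
      using cont by (simp add: isCont_def tendsto_at_iff_tendsto_nhds)
  qed (use U U' \<gamma>(2) in auto)
  \<comment> \<open>\<open>v - (\<gamma> t \<bullet> v) *\<^sub>R \<gamma> t\<close> is tangent at
    \<open>\<gamma> t\<close>, where both extensions agree with \<open>\<alpha>\<close>.\<close>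
  have split: "\<delta> (\<gamma> t) v = (\<gamma> t \<bullet> v) * c t" if t: "\<gamma> t \<in> U \<inter> U'" for t
  proof -
    have "\<gamma> t \<in> sphere 0 1" using \<gamma>(1) by blast
    then have n: "norm (\<gamma> t) = 1" by simp
    then have "\<gamma> t \<bullet> (v - (\<gamma> t \<bullet> v) *\<^sub>R \<gamma> t) = 0"
      by (simp add: inner_diff_right norm_eq_1)
    then have "\<delta> (\<gamma> t) (v - (\<gamma> t \<bullet> v) *\<^sub>R \<gamma> t) = 0"
      using eq[OF _ n] eq'[OF _ n] t by (simp add: \<delta>_def)
    then show ?thesis
      using lin[OF t] c[OF t] by (simp add: linear_diff linear_scale)
  qed
  \<comment> \<open>Since \<open>\<gamma> t \<bullet> v\<close> vanishes at \<open>0\<close>, this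
    is the difference quotient of \<open>(\<gamma> t \<bullet> v) * c t\<close>, and continuity of
    \<open>c\<close> suffices for its limit.\<close>
  have "((\<lambda>h. (\<gamma> h \<bullet> v) / h * c h) \<longlongrightarrow> (u \<bullet> v) * c 0) (at 0)"
  proof (intro tendsto_mult)
    have "((\<lambda>t. \<gamma> t \<bullet> v) has_vector_derivative u \<bullet> v) (at 0)"
      by (rule bounded_linear.has_vector_derivative[OF bounded_linear_inner_left \<gamma>'])
    then have "((\<lambda>t. \<gamma> t \<bullet> v) has_real_derivative u \<bullet> v) (at 0)"
      by (simp add: has_real_derivative_iff_has_vector_derivative)
    then show "((\<lambda>h. (\<gamma> h \<bullet> v) / h) \<longlongrightarrow> u \<bullet> v) (at 0)"
      using v by (simp add: DERIV_def \<gamma>(2))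
    show "(c \<longlongrightarrow> c 0) (at 0)"
      using \<open>isCont c 0\<close> by (simp add: isCont_def)
  qed
  then have "((\<lambda>t. (\<gamma> t \<bullet> v) * c t) has_real_derivative (u \<bullet> v) * c 0) (at 0)"
    using v by (simp add: DERIV_def \<gamma>(2) times_divide_eq_left)
  then have "((\<lambda>t. \<delta> (\<gamma> t) v) has_real_derivative (u \<bullet> v) * c 0) (at 0)"
    using near split by (subst DERIV_cong_ev[OF refl _ refl, where g = "\<lambda>t. (\<gamma> t \<bullet> v) * c t"])
      (auto elim: eventually_mono)
  then have "frechet_derivative (\<lambda>x. \<beta> x v) (at p) u - frechet_derivative (\<lambda>x. \<beta>' x v) (at p) u =
      (u \<bullet> v) * c 0"
    using along DERIV_unique by blast
  moreover have "c 0 = \<beta> p p - \<beta>' p p"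
    using c[of 0] U(2) U'(2) by (simp add: \<gamma>(2) \<delta>_def)
  ultimately show ?thesis by simp
qed

text \<open>Passing from the extension chosen by \<open>SOME\<close> to \<open>\<beta>\<close>
  changes each of the two terms by the same multiple of \<open>u \<bullet> v\<close>, which cancels.
  Hence any convenient extension computes \<open>ext_deriv\<close>.\<close>

lemma ext_deriv_sphere:
  assumes "local_extension (sphere 0 1) \<alpha> p \<beta>" "norm p = 1" "p \<bullet> u = 0" "p \<bullet> v = 0"
  shows "ext_deriv (sphere 0 1) \<alpha> p u v =
    frechet_derivative (\<lambda>x. \<beta> x v) (at p) u - frechet_derivative (\<lambda>x. \<beta> x u) (at p) v"
proof -
  define \<beta>' where "\<beta>' = (SOME \<beta>. local_extension (sphere 0 1) \<alpha> p \<beta>)"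
  have "local_extension (sphere 0 1) \<alpha> p \<beta>'"
    unfolding \<beta>'_def by (rule someI[of "local_extension (sphere 0 1) \<alpha> p", OF assms(1)])
  from local_extension_sphere_difference[OF assms(1) this assms(2,3,4)]
    local_extension_sphere_difference[OF assms(1) this assms(2,4,3)]
  show ?thesis
    by (simp add: ext_deriv_def Let_def \<beta>'_def[symmetric] inner_commute)
qed

section \<open>Ellipsoid contact forms\<close>

text \<open>The complex structure. It is a skew isometry for the real inner product and
  \<open>liouville z v\<close> is half of \<open>mult_i z \<bullet> v\<close>, so computations with
  forms become linear algebra with \<open>mult_i\<close> and the self-adjoint map
  \<open>weight b\<close>.\<close>

definition mult_i :: "complex ^ 'n::finite \<Rightarrow> complex ^ 'n" where
  "mult_i z = (\<chi> j. \<i> * z $ j)"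

text \<open>\<open>weight b\<close> is the gradient of the quadratic form \<open>ellipsoid_fun b\<close>.\<close>

definition weight :: "real ^ 'n::finite \<Rightarrow> complex ^ 'n \<Rightarrow> complex ^ 'n" where
  "weight b z = (\<chi> j. (2 * pi / b $ j) *\<^sub>R z $ j)"

lemma bounded_linear_mult_i: "bounded_linear mult_i"
  by (auto intro!: linearI simp: linear_conv_bounded_linear[symmetric] mult_i_def vec_eq_iff algebra_simps)

lemma bounded_linear_weight: "bounded_linear (weight b)"
  by (auto intro!: linearI simp: linear_conv_bounded_linear[symmetric] weight_def vec_eq_iff algebra_simps)

lemma mult_i_inner: "mult_i z \<bullet> v = - (z \<bullet> mult_i v)"
  by (simp add: mult_i_def inner_vec_def inner_complex_def sum_negf[symmetric] algebra_simps)

lemma mult_i_mult_i: "mult_i (mult_i z) = - z"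
  by (simp add: mult_i_def vec_eq_iff mult.assoc[symmetric])

lemma inner_mult_i_self: "z \<bullet> mult_i z = 0"
  by (simp add: mult_i_def inner_vec_def inner_complex_def algebra_simps)

lemma inner_mult_i_mult_i: "mult_i z \<bullet> mult_i v = z \<bullet> v"
  by (simp add: mult_i_inner mult_i_mult_i)

lemma weight_inner: "weight b z \<bullet> v = z \<bullet> weight b v"
  by (simp add: weight_def inner_vec_def)

text \<open>Coordinatewise, \<open>mult_i (weight b z)\<close> is a real multiple of \<i> times
  \<open>z $ j\<close>, which is orthogonal to \<open>z $ j\<close> in the complex plane.\<close>

lemma inner_mult_i_weight: "z \<bullet> mult_i (weight b z) = 0"
  by (auto simp: mult_i_def weight_def inner_vec_def inner_complex_def intro!: sum.neutral)

lemma liouville_eq: "liouville z v = (1 / 2) * (mult_i z \<bullet> v)"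
  by (simp add: liouville_def mult_i_def inner_vec_def inner_complex_def algebra_simps)

lemma ellipsoid_fun_eq: "ellipsoid_fun b z = (1 / 2) * (weight b z \<bullet> z)"
  by (simp add: ellipsoid_fun_def weight_def inner_vec_def sum_distrib_left dot_square_norm)

lemma ellipsoid_fun_pos:
  assumes "\<And>j. 0 < b $ j" "z \<noteq> 0"
  shows "0 < ellipsoid_fun b z"
proof -
  obtain j where "z $ j \<noteq> 0" using assms(2) by (auto simp: vec_eq_iff)
  with assms(1)[of j] have "0 < pi / b $ j * (cmod (z $ j))\<^sup>2" by simp
  then show ?thesis
    unfolding ellipsoid_fun_def using assms(1)
    by (intro sum_pos2[of UNIV j]) (simp_all add: less_imp_le)
qed

section \<open>Exterior derivative, contact condition and Reeb field\<close>

lemma ellipsoid_fun_has_derivative: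
  "(ellipsoid_fun b has_derivative (\<lambda>h. weight b z \<bullet> h)) (at z)"
proof -
  have "((\<lambda>z. (1 / 2) * (weight b z \<bullet> z)) has_derivative
      (\<lambda>h. (1 / 2) * (weight b z \<bullet> h + weight b h \<bullet> z))) (at z)"
    by (intro has_derivative_mult_right has_derivative_inner has_derivative_ident
        bounded_linear_imp_has_derivative bounded_linear_weight)
  then show ?thesis
    by (simp add: ellipsoid_fun_eq[abs_def] weight_inner[of b _ z] inner_commute[of _ "weight b z"])
qed

lemma smooth_on_ellipsoid_fun: "open U \<Longrightarrow> smooth_on U (ellipsoid_fun b)"
  unfolding ellipsoid_fun_eq[abs_def]
  by (intro smooth_on_mult smooth_on_inner smooth_on_const smooth_on_id smooth_on_linear
      bounded_linear_weight)

lemma ellipsoid_form_eq: "ellipsoid_form b z v = inverse (ellipsoid_fun b z) * ((1 / 2) * (mult_i z \<bullet> v))"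
  by (simp add: ellipsoid_form_def liouville_eq)

text \<open>The defining formula makes sense and is smooth away from the origin, so the form is its
  own extension.\<close>

lemma local_extension_ellipsoid_form:
  assumes "\<And>j. 0 < b $ j" "norm p = 1"
  shows "local_extension (sphere 0 1) (ellipsoid_form b) p (ellipsoid_form b)"
  unfolding local_extension_def
proof (intro exI[of _ "- {0}"] conjI allI ballI)
  show "open (- {0 :: complex ^ 'a})" by auto
  show "p \<in> - {0}" using assms(2) by auto
  show "linear (ellipsoid_form b x)" for x
    by (intro linearI) (simp_all add: ellipsoid_form_eq inner_add_right algebra_simps)
  show "smooth_on (- {0}) (\<lambda>x. ellipsoid_form b x v)" for v
    unfolding ellipsoid_form_eq
    by (intro smooth_on_mult smooth_on_inverse smooth_on_inner smooth_on_const smooth_on_linear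
        bounded_linear_mult_i smooth_on_ellipsoid_fun)
      (auto dest: ellipsoid_fun_pos[OF assms(1)])
qed auto

text \<open>Leibniz rule for \<open>h\<close> times \<lambda> with
  \<open>h = 1 / ellipsoid_fun b\<close>: the first term is \<open>h\<close> times d\<lambda>, where
  d\<lambda>(u, v) is \<open>mult_i u \<bullet> v\<close>, and the second is the wedge of dh with
  \<lambda>, where dh(u) is \<open>- h^2 * (weight b p \<bullet> u)\<close>.\<close>

lemma ext_deriv_ellipsoid_form:
  assumes b: "\<And>j. 0 < b $ j" and p: "norm p = 1" "p \<bullet> u = 0" "p \<bullet> v = 0"
  shows "ext_deriv (sphere 0 1) (ellipsoid_form b) p u v =
    inverse (ellipsoid_fun b p) * (mult_i u \<bullet> v) -
    (inverse (ellipsoid_fun b p))\<^sup>2 / 2 *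
      ((weight b p \<bullet> u) * (mult_i p \<bullet> v) - (weight b p \<bullet> v) * (mult_i p \<bullet> u))"
proof -
  let ?h = "inverse (ellipsoid_fun b p)"
  have "p \<noteq> 0" using p(1) by auto
  then have "ellipsoid_fun b p \<noteq> 0" using ellipsoid_fun_pos[OF b] by force
  then have der: "((\<lambda>x. ellipsoid_form b x v) has_derivative
      (\<lambda>u. ?h * ((1 / 2) * (mult_i u \<bullet> v)) +
        (- (?h * (weight b p \<bullet> u) * ?h)) * ((1 / 2) * (mult_i p \<bullet> v)))) (at p)" for v
    unfolding ellipsoid_form_eq
    by (intro has_derivative_mult Deriv.has_derivative_inverse ellipsoid_fun_has_derivative
        has_derivative_mult_right has_derivative_inner_left bounded_linear_imp_has_derivative
        bounded_linear_mult_i)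
  note frechet_derivative_at[OF der, symmetric]
  then show ?thesis
    unfolding ext_deriv_sphere[OF local_extension_ellipsoid_form[OF b p(1)] p]
    by (simp add: mult_i_inner[of v u] inner_commute[of v] power2_eq_square algebra_simps)
qed

text \<open>The contact hyperplane is orthogonal to \<open>p\<close> and \<open>mult_i p\<close>,
  hence invariant under \<open>mult_i\<close>. Testing against \<open>mult_i u\<close> kills the
  wedge term and leaves a nonzero multiple of \<open>u \<bullet> u\<close>.\<close>

lemma ellipsoid_form_nondegenerate:
  assumes b: "\<And>j. 0 < b $ j" and p: "norm p = 1" and u: "p \<bullet> u = 0" "ellipsoid_form b p u = 0"
    and deg: "\<And>v. p \<bullet> v = 0 \<Longrightarrow> ellipsoid_form b p v = 0 \<Longrightarrow>
      ext_deriv (sphere 0 1) (ellipsoid_form b) p u v = 0"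
  shows "u = 0"
proof -
  have "p \<noteq> 0" using p by auto
  then have f: "ellipsoid_fun b p \<noteq> 0" using ellipsoid_fun_pos[OF b] by force
  then have Jpu: "mult_i p \<bullet> u = 0" using u(2) by (simp add: ellipsoid_form_eq)
  then have 1: "p \<bullet> mult_i u = 0" by (simp add: mult_i_inner)
  moreover have 2: "mult_i p \<bullet> mult_i u = 0" using u(1) by (simp add: inner_mult_i_mult_i)
  ultimately have "ext_deriv (sphere 0 1) (ellipsoid_form b) p u (mult_i u) = 0"
    by (intro deg) (simp_all add: ellipsoid_form_eq)
  then show ?thesis
    unfolding ext_deriv_ellipsoid_form[OF b p u(1) 1] using f 2 Jpu
    by (simp add: inner_mult_i_mult_i)
qed

lemma contact_form_ellipsoid_form:
  assumes b: "\<And>j. 0 < b $ j"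
  shows "contact_form (sphere 0 1) std_contact_structure (ellipsoid_form b)"
  unfolding contact_form_def
proof (intro conjI ballI impI)
  show "\<exists>d. embedded_submanifold d (sphere (0 :: complex ^ 'a) 1)"
    using embedded_submanifold_sphere by blast
  show "smooth_one_form (sphere 0 1) (ellipsoid_form b)"
    unfolding smooth_one_form_def
  proof
    fix p :: "complex ^ 'a" assume "p \<in> sphere 0 1"
    then have "norm p = 1" by simp
    then show "\<exists>\<beta>. local_extension (sphere 0 1) (ellipsoid_form b) p \<beta>"
      by (intro exI[of _ "ellipsoid_form b"] local_extension_ellipsoid_form b)
  qed
next
  fix p :: "complex ^ 'a" assume "p \<in> sphere 0 1"
  then have p: "norm p = 1" by simp
  then have "p \<noteq> 0" by auto
  then have f: "ellipsoid_fun b p \<noteq> 0" using ellipsoid_fun_pos[OF b] by force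
  \<comment> \<open>The vector \<open>mult_i p\<close> is tangent, and \<lambda> takes the value
    \<open>(p \<bullet> p) / 2\<close> on it.\<close>
  have "ellipsoid_form b p (mult_i p) \<noteq> 0"
    using f \<open>p \<noteq> 0\<close> by (simp add: ellipsoid_form_eq inner_mult_i_mult_i)
  then show "\<exists>v\<in>tangent_space (sphere 0 1) p. ellipsoid_form b p v \<noteq> 0"
    by (intro bexI[of _ "mult_i p"]) (simp_all add: tangent_space_sphere[OF p] inner_mult_i_self)
  show kernel: "std_contact_structure p = {v \<in> tangent_space (sphere 0 1) p. ellipsoid_form b p v = 0}"
    using f by (simp add: std_contact_structure_def ellipsoid_form_def)
  show "u = 0" if "u \<in> std_contact_structure p"
    and "\<forall>v\<in>std_contact_structure p. ext_deriv (sphere 0 1) (ellipsoid_form b) p u v = 0" for u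
    using that ellipsoid_form_nondegenerate[OF b p, of u]
    by (simp add: kernel tangent_space_sphere[OF p])
qed

text \<open>The candidate is checked directly. For uniqueness, the difference of two solutions lies
  in the kernel of the form and pairs to zero with all tangent vectors, so nondegeneracy makes it
  vanish.\<close>

lemma reeb_field_ellipsoid_form:
  assumes b: "\<And>j. 0 < b $ j" and p: "norm p = 1"
  shows "reeb_field (sphere 0 1) (ellipsoid_form b) p = mult_i (weight b p)"
  unfolding reeb_field_def tangent_space_sphere[OF p]
proof (rule the_equality)
  let ?R = "mult_i (weight b p)"
  have "p \<noteq> 0" using p by auto
  then have f: "ellipsoid_fun b p \<noteq> 0" using ellipsoid_fun_pos[OF b] by force
  have wp: "p \<bullet> weight b p = 2 * ellipsoid_fun b p"
    by (simp add: ellipsoid_fun_eq weight_inner)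
  have tan: "p \<bullet> ?R = 0" by (rule inner_mult_i_weight)
  have one: "ellipsoid_form b p ?R = 1"
    using f by (simp add: ellipsoid_form_eq inner_mult_i_mult_i wp)
  \<comment> \<open>With \<open>h = inverse (ellipsoid_fun b p)\<close>, the d\<lambda> term is
    \<open>- h * (weight b p \<bullet> v)\<close>. The wedge term cancels it, because
    \<open>mult_i p \<bullet> ?R\<close> is twice \<open>ellipsoid_fun b p\<close> and
    \<open>weight b p \<bullet> ?R\<close> is zero.\<close>
  have ker: "ext_deriv (sphere 0 1) (ellipsoid_form b) p ?R v = 0" if "p \<bullet> v = 0" for v
    unfolding ext_deriv_ellipsoid_form[OF b p tan that]
    using f by (simp add: inner_mult_i_mult_i mult_i_mult_i wp inner_mult_i_self power2_eq_square field_simps)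
  show "?R \<in> {v. p \<bullet> v = 0} \<and> ellipsoid_form b p ?R = 1 \<and>
      (\<forall>v\<in>{v. p \<bullet> v = 0}. ext_deriv (sphere 0 1) (ellipsoid_form b) p ?R v = 0)"
    using tan one ker by simp
  fix R
  assume R: "R \<in> {v. p \<bullet> v = 0} \<and> ellipsoid_form b p R = 1 \<and>
      (\<forall>v\<in>{v. p \<bullet> v = 0}. ext_deriv (sphere 0 1) (ellipsoid_form b) p R v = 0)"
  have t: "p \<bullet> (R - ?R) = 0" using R tan by (simp add: inner_diff_right)
  have "R - ?R = 0"
  proof (rule ellipsoid_form_nondegenerate[OF b p t])
    have "ellipsoid_form b p (R - ?R) = ellipsoid_form b p R - ellipsoid_form b p ?R"
      by (simp add: ellipsoid_form_eq inner_diff_right algebra_simps)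
    then show "ellipsoid_form b p (R - ?R) = 0" using R one by simp
    fix v assume v: "p \<bullet> v = 0"
    have "ext_deriv (sphere 0 1) (ellipsoid_form b) p (R - ?R) v =
        ext_deriv (sphere 0 1) (ellipsoid_form b) p R v - ext_deriv (sphere 0 1) (ellipsoid_form b) p ?R v"
      using R t tan v
      by (simp add: ext_deriv_ellipsoid_form[OF b p] inner_diff_right inner_diff_left
          bounded_linear.linear[OF bounded_linear_mult_i, THEN linear_diff] algebra_simps)
    then show "ext_deriv (sphere 0 1) (ellipsoid_form b) p (R - ?R) v = 0"
      using R v ker by simp
  qed
  then show "R = ?R" by simp
qed

section \<open>The Reeb flow and its periods\<close>

definition ellipsoid_flow :: "real ^ 'n::finite \<Rightarrow> real \<Rightarrow> complex ^ 'n \<Rightarrow> complex ^ 'n" where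
  "ellipsoid_flow b t z = (\<chi> j. cis (2 * pi * t / b $ j) * z $ j)"

lemma norm_ellipsoid_flow: "norm (ellipsoid_flow b t z) = norm z"
  by (simp add: norm_vec_def ellipsoid_flow_def norm_mult)

lemma ellipsoid_flow_has_vector_derivative:
  "((\<lambda>t. ellipsoid_flow b t z) has_vector_derivative mult_i (weight b (ellipsoid_flow b t z))) (at t)"
proof -
  \<comment> \<open>Writing a vector as a sum of its coordinate embeddings reduces its derivative to
    the coordinates, through linearity and the sum rule.\<close>
  have axis: "(\<chi> j. x j) = (\<Sum>j\<in>UNIV. axis j (x j))" for x :: "'a \<Rightarrow> complex"
    by (simp add: vec_eq_iff axis_def)
  have lin: "bounded_linear (axis j :: complex \<Rightarrow> complex ^ 'a)" for j
    by (auto intro!: linearI simp: linear_conv_bounded_linear[symmetric] axis_def vec_eq_iff)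
  have "((\<lambda>t. cis (2 * pi * t / b $ j) * z $ j) has_vector_derivative
      \<i> * ((2 * pi / b $ j) *\<^sub>R (cis (2 * pi * t / b $ j) * z $ j))) (at t)" for j
  proof -
    have "((\<lambda>t. 2 * pi * t / b $ j) has_vector_derivative 2 * pi / b $ j) (at t)"
      unfolding has_real_derivative_iff_has_vector_derivative[symmetric]
      using DERIV_cmult[OF DERIV_ident, of "2 * pi / b $ j" t UNIV] by simp
    then have "((\<lambda>t. cis (2 * pi * t / b $ j)) has_vector_derivative
        (2 * pi / b $ j) *\<^sub>R (\<i> * cis (2 * pi * t / b $ j))) (at t)"
      unfolding has_vector_derivative_def
      by (rule has_derivative_eq_rhs[OF has_derivative_cis]) simp
    from bounded_linear.has_vector_derivative[OF bounded_linear_mult_left this, of "z $ j"]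
    show ?thesis by (simp add: algebra_simps)
  qed
  then have "((\<lambda>t. \<Sum>j\<in>UNIV. axis j (cis (2 * pi * t / b $ j) * z $ j)) has_vector_derivative
      (\<Sum>j\<in>UNIV. axis j (\<i> * ((2 * pi / b $ j) *\<^sub>R (cis (2 * pi * t / b $ j) * z $ j))))) (at t)"
    by (intro has_vector_derivative_sum bounded_linear.has_vector_derivative[OF lin])
  then show ?thesis
    by (simp add: axis[symmetric] ellipsoid_flow_def mult_i_def weight_def)
qed

lemma reeb_flow_ellipsoid_flow:
  assumes "\<And>j. 0 < b $ j"
  shows "reeb_flow (sphere 0 1) (ellipsoid_form b) (ellipsoid_flow b)"
  unfolding reeb_flow_def
proof (intro ballI conjI allI)
  fix p :: "complex ^ 'a" and t assume "p \<in> sphere 0 1"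
  then have "norm (ellipsoid_flow b t p) = 1" by (simp add: norm_ellipsoid_flow)
  then show "ellipsoid_flow b t p \<in> sphere 0 1"
    and "((\<lambda>s. ellipsoid_flow b s p) has_vector_derivative
      reeb_field (sphere 0 1) (ellipsoid_form b) (ellipsoid_flow b t p)) (at t)"
    using ellipsoid_flow_has_vector_derivative reeb_field_ellipsoid_form[OF assms]
    by simp_all
  show "ellipsoid_flow b 0 p = p" by (simp add: ellipsoid_flow_def vec_eq_iff)
qed

lemma cis_2pi_eq_1_iff: "cis (2 * pi * x) = 1 \<longleftrightarrow> x \<in> \<int>"
proof -
  have "cis (2 * pi * x) = 1 \<longleftrightarrow> cos (2 * pi * x) = 1"
    using cos_one_sin_zero[of "2 * pi * x"] by (auto simp: complex_eq_iff)
  also have "\<dots> \<longleftrightarrow> (\<exists>n::int. x = n)"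
    by (auto simp: cos_one_2pi_int)
  finally show ?thesis by (auto simp: Ints_def)
qed

lemma ellipsoid_flow_eq_id_iff:
  "(\<forall>p\<in>sphere 0 1. ellipsoid_flow b t p = p) \<longleftrightarrow> (\<forall>j. t / b $ j \<in> \<int>)"
proof
  assume id: "\<forall>p\<in>sphere 0 1. ellipsoid_flow b t p = p"
  show "\<forall>j. t / b $ j \<in> \<int>"
  proof
    fix j
    \<comment> \<open>The unit vector along coordinate \<open>j\<close> lies on the sphere and sees
      only the rotation in that coordinate.\<close>
    have "ellipsoid_flow b t (axis j 1) $ j = axis j 1 $ j" using id by simp
    then show "t / b $ j \<in> \<int>"
      using cis_2pi_eq_1_iff[of "t / b $ j"] by (simp add: ellipsoid_flow_def)
  qed
next
  assume "\<forall>j. t / b $ j \<in> \<int>"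
  then have "cis (2 * pi * t / b $ j) = 1" for j
    using cis_2pi_eq_1_iff[of "t / b $ j"] by simp
  then show "\<forall>p\<in>sphere 0 1. ellipsoid_flow b t p = p"
    by (simp add: ellipsoid_flow_def)
qed

text \<open>Fix any coordinate \<open>i\<close>. All positive periods are integer multiples of
  \<open>b $ i\<close>, so they are indexed by a set of natural numbers, nonempty because of
  \<open>T0\<close>, and the least element gives the minimal period.\<close>

lemma ellipsoid_flow_minimal_period:
  assumes b: "\<And>j. 0 < b $ j" and T0: "0 < T0" "\<And>j. T0 / b $ j \<in> \<int>"
  obtains T where "T \<le> T0" "periodic_flow (sphere 0 1) (ellipsoid_flow b) T"
proof -
  fix i :: 'a
  define P where "P m \<longleftrightarrow> 0 < m \<and> (\<forall>j. b $ i * real m / b $ j \<in> \<int>)" for m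
  define m where "m = (LEAST m. P m)"
  have period: "\<exists>m. t = b $ i * real m \<and> P m" if t: "0 < t" "\<And>j. t / b $ j \<in> \<int>" for t
  proof -
    have "0 < t / b $ i" using t(1) b by simp
    then obtain k :: nat where k: "t / b $ i = real k"
      using t(2)[of i] by (metis Ints_cases nonneg_int_cases of_int_0_le_iff of_int_of_nat_eq less_imp_le)
    then have "t = b $ i * real k" using b[of i] by (simp add: field_simps)
    moreover have "0 < k" using k \<open>0 < t / b $ i\<close> by (metis of_nat_0_less_iff)
    ultimately show ?thesis using t(2) by (auto simp: P_def)
  qed
  have "\<exists>m. P m" using period[OF T0] by blast
  then have Pm: "P m" unfolding m_def by (rule LeastI_ex)
  have least: "b $ i * real m \<le> t" if t: "0 < t" "\<And>j. t / b $ j \<in> \<int>" for t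
  proof -
    obtain k where k: "t = b $ i * real k" "P k" using period[OF t] by blast
    then have "m \<le> k" unfolding m_def by (intro Least_le)
    then show ?thesis using b[of i] k(1) by simp
  qed
  have "periodic_flow (sphere 0 1) (ellipsoid_flow b) (b $ i * real m)"
    unfolding periodic_flow_def
  proof (intro conjI allI impI)
    show "0 < b $ i * real m" using Pm b by (simp add: P_def)
    show "\<forall>p\<in>sphere 0 1. ellipsoid_flow b (b $ i * real m) p = p"
      using Pm by (simp add: ellipsoid_flow_eq_id_iff P_def)
    fix t assume "0 < t \<and> t < b $ i * real m"
    then have "\<not> (\<forall>j. t / b $ j \<in> \<int>)" using least[of t] by auto
    then show "\<exists>p\<in>sphere 0 1. ellipsoid_flow b t p \<noteq> p"
      using ellipsoid_flow_eq_id_iff[of b t] by blast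
  qed
  then show thesis using that least[OF T0] by blast
qed

section \<open>Simultaneous approximation\<close>

lemma simultaneous_rational_approximation:
  fixes a :: "real ^ 'n::finite"
  assumes a: "\<And>j. 0 < a $ j" and N: "2 \<le> N"
  obtains b T where "\<And>j. 0 < b $ j" "0 < T" "\<And>j. T / b $ j \<in> \<int>"
    "\<And>j. \<bar>ln (a $ j) - ln (b $ j)\<bar> \<le> 2 * (\<Sum>j\<in>UNIV. a $ j) / (real N * T)"
proof -
  \<comment> \<open>As \<open>A\<close> dominates every \<open>a $ j\<close>, approximating the
    ratios \<open>A / a $ j\<close> makes \<open>T = q * A\<close> at least each
    \<open>a $ j\<close>, which keeps all \<open>x j\<close> at least 1.\<close>
  define A where "A = (\<Sum>j\<in>UNIV. a $ j)"
  have aA: "a $ j \<le> A" for j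
    unfolding A_def by (rule member_le_sum) (use a in \<open>auto intro: less_imp_le\<close>)
  have "0 < A" using a aA less_le_trans by blast
  \<comment> \<open>Dirichlet's theorem is indexed by natural numbers, so the coordinates are
    enumerated.\<close>
  obtain h :: "nat \<Rightarrow> 'n" where h: "bij_betw h {0..<CARD('n)} UNIV"
    using ex_bij_betw_nat_finite[OF finite_class.finite_UNIV] by blast
  obtain q p where q: "0 < q" and
    pq: "\<And>i. i < CARD('n) \<Longrightarrow> \<bar>of_int q * (A / a $ h i) - of_int (p i)\<bar> < 1 / real N"
  proof (rule Dirichlet_approx_simult[of N "CARD('n)" "\<lambda>i. A / a $ h i"])
    show "0 < N" using N by simp
  qed blast
  have "\<exists>k::int. \<bar>of_int q * (A / a $ j) - of_int k\<bar> < 1 / real N" for j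
  proof -
    have "j \<in> h ` {0..<CARD('n)}" using h by (simp add: bij_betw_def)
    then show ?thesis using pq by force
  qed
  then obtain k :: "'n \<Rightarrow> int" where k: "\<And>j. \<bar>of_int q * (A / a $ j) - of_int (k j)\<bar> < 1 / real N"
    by metis
  define T where "T = of_int q * A"
  have T: "0 < T" using q \<open>0 < A\<close> by (simp add: T_def)
  define x where "x j = T / a $ j" for j
  have x: "1 \<le> x j" for j
  proof -
    have "1 \<le> real_of_int q" using q by simp
    with aA[of j] \<open>0 < A\<close> have "1 * a $ j \<le> T" unfolding T_def
      using a[of j] by (intro mult_mono) auto
    then show ?thesis using a[of j] by (simp add: x_def field_simps)
  qed
  have xk: "\<bar>x j - of_int (k j)\<bar> < 1 / real N" for j
    using k[of j] by (simp add: x_def T_def)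
  \<comment> \<open>Here \<open>2 \<le> N\<close> matters: the rounding error is at most 1/2, hence
    at most \<open>x j / 2\<close>, so \<open>k j\<close> is positive and comparable to
    \<open>x j\<close>.\<close>
  have "1 / real N \<le> 1 / 2" using N by (intro divide_left_mono) auto
  then have kx: "x j / 2 \<le> of_int (k j)" for j
    using xk[of j] x[of j] by linarith
  then have k0: "0 < real_of_int (k j)" for j
    using x[of j] by (smt (verit) half_gt_zero)
  define b where "b = (\<chi> j. T / of_int (k j))"
  have b: "0 < b $ j" for j using T k0[of j] by (simp add: b_def)
  show thesis
  proof
    show "0 < b $ j" for j by (rule b)
    show "0 < T" by (rule T)
    show "T / b $ j \<in> \<int>" for j using T by (simp add: b_def)
    fix j
    have "0 < x j" using x[of j] by simp
    have "ln (a $ j) - ln (b $ j) = ln (of_int (k j)) - ln (x j)"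
      using T a[of j] k0[of j] by (simp add: b_def x_def ln_div)
    \<comment> \<open>The estimate \<open>ln s - ln t \<le> (s - t) / t\<close> is used in both
      directions; either denominator, \<open>x j\<close> or \<open>k j\<close>, is at least
      \<open>x j / 2\<close>.\<close>
    moreover have "ln (of_int (k j)) - ln (x j) \<le> (of_int (k j) - x j) / x j"
      using ln_diff_le[OF k0[of j] \<open>0 < x j\<close>] .
    moreover have "(of_int (k j) - x j) / x j \<le> (1 / real N) / (x j / 2)"
      using xk[of j] \<open>0 < x j\<close> by (intro frac_le) auto
    moreover have "ln (x j) - ln (of_int (k j)) \<le> (x j - of_int (k j)) / of_int (k j)"
      using ln_diff_le[OF \<open>0 < x j\<close> k0[of j]] .
    moreover have "(x j - of_int (k j)) / of_int (k j) \<le> (1 / real N) / (x j / 2)"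
      using xk[of j] \<open>0 < x j\<close> kx[of j] by (intro frac_le) auto
    ultimately have "\<bar>ln (a $ j) - ln (b $ j)\<bar> \<le> (1 / real N) / (x j / 2)" by linarith
    also have "\<dots> = 2 * a $ j / (real N * T)" using T by (simp add: x_def field_simps)
    also have "\<dots> \<le> 2 * A / (real N * T)" using T aA[of j] by (intro divide_right_mono) auto
    finally show "\<bar>ln (a $ j) - ln (b $ j)\<bar> \<le> 2 * (\<Sum>j\<in>UNIV. a $ j) / (real N * T)"
      by (simp add: A_def)
  qed
qed

section \<open>From the weights to Hofer near-periodicity\<close>

lemma ellipsoid_fun_ln_diff_le:
  assumes a: "\<And>j. 0 < a $ j" and b: "\<And>j. 0 < b $ j" and "z \<noteq> 0"
    and le: "\<And>j. ln (b $ j) - ln (a $ j) \<le> \<delta>"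
  shows "ln (ellipsoid_fun a z) - ln (ellipsoid_fun b z) \<le> \<delta>"
proof -
  \<comment> \<open>Exponentiating the hypothesis compares the two quadratic forms coefficient by
    coefficient, with the common factor \<open>exp \<delta>\<close>.\<close>
  have "b $ j \<le> exp \<delta> * a $ j" for j
  proof -
    have "ln (b $ j) \<le> ln (exp \<delta> * a $ j)" using le[of j] a[of j] by (simp add: ln_mult)
    then show ?thesis using a b by simp
  qed
  then have "1 / a $ j \<le> exp \<delta> / b $ j" for j
    using a[of j] b[of j] by (simp add: field_simps)
  then have "pi / a $ j * (cmod (z $ j))\<^sup>2 \<le> exp \<delta> * (pi / b $ j * (cmod (z $ j))\<^sup>2)" for j
    using mult_left_mono[of "1 / a $ j" "exp \<delta> / b $ j" "pi * (cmod (z $ j))\<^sup>2"]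
    by (simp add: algebra_simps)
  then have "ellipsoid_fun a z \<le> exp \<delta> * ellipsoid_fun b z"
    unfolding ellipsoid_fun_def sum_distrib_left by (intro sum_mono)
  moreover have "0 < ellipsoid_fun a z" "0 < ellipsoid_fun b z"
    using assms by (auto intro: ellipsoid_fun_pos)
  ultimately have "ln (ellipsoid_fun a z) \<le> ln (exp \<delta> * ellipsoid_fun b z)" by simp
  then show ?thesis using \<open>0 < ellipsoid_fun b z\<close> by (simp add: ln_mult)
qed

lemma Hofer_near_periodic_ellipsoid_form:
  fixes a :: "real ^ 'n::finite"
  assumes a: "\<And>j. 0 < a $ j"
  shows "Hofer_near_periodic (sphere (0 :: complex ^ 'n) 1) std_contact_structure (ellipsoid_form a)"
proof -
  let ?S = "sphere (0 :: complex ^ 'n) 1"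
  define A where "A = (\<Sum>j\<in>UNIV. a $ j)"
  \<comment> \<open>\<open>T0\<close> is the common period produced by the approximation and
    \<open>T\<close> the minimal one. The index \<open>i + 2\<close> provides the bound
    \<open>2 \<le> N\<close>.\<close>
  have "\<exists>b T T0. (\<forall>j. 0 < b $ j) \<and> T \<le> T0 \<and> periodic_flow ?S (ellipsoid_flow b) T \<and> 0 < T0 \<and>
      (\<forall>j. \<bar>ln (a $ j) - ln (b $ j)\<bar> \<le> 2 * A / (real (i + 2) * T0))" for i
  proof -
    obtain b T0 where b: "\<And>j. 0 < b $ j" "0 < T0" "\<And>j. T0 / b $ j \<in> \<int>"
      "\<And>j. \<bar>ln (a $ j) - ln (b $ j)\<bar> \<le> 2 * A / (real (i + 2) * T0)"
      unfolding A_def using simultaneous_rational_approximation[OF a, of "i + 2"] by auto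
    obtain T where "T \<le> T0" "periodic_flow ?S (ellipsoid_flow b) T"
      using ellipsoid_flow_minimal_period b(1-3) by blast
    with b show ?thesis by blast
  qed
  then obtain b :: "nat \<Rightarrow> real ^ 'n" and T T0 where b: "\<And>i j. 0 < b i $ j" and TT0: "\<And>i. T i \<le> T0 i"
    and T: "\<And>i. periodic_flow ?S (ellipsoid_flow (b i)) (T i)" and T0: "\<And>i. 0 < T0 i"
    and ab: "\<And>i j. \<bar>ln (a $ j) - ln (b i $ j)\<bar> \<le> 2 * A / (real (i + 2) * T0 i)"
    by metis
  define f where "f i p = ln (ellipsoid_fun a p) - ln (ellipsoid_fun (b i) p)" for i p
  have form: "(\<lambda>p v. exp (f i p) * ellipsoid_form a p v) = ellipsoid_form (b i)" for i
  proof (intro ext)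
    fix p v :: "complex ^ 'n"
    show "exp (f i p) * ellipsoid_form a p v = ellipsoid_form (b i) p v"
    \<comment> \<open>The forms are equated as functions on the whole space. At the origin the
      logarithms say nothing, but there the Liouville form vanishes.\<close>
    proof (cases "p = 0")
      case True
      then show ?thesis by (simp add: ellipsoid_form_def liouville_def)
    next
      case False
      then have "0 < ellipsoid_fun a p" "0 < ellipsoid_fun (b i) p"
        using a b by (auto intro: ellipsoid_fun_pos)
      then show ?thesis by (simp add: ellipsoid_form_def f_def exp_diff field_simps)
    qed
  qed
  have bound: "\<bar>f i p\<bar> \<le> 2 * A / (real (i + 2) * T0 i)" if "p \<in> ?S" for i p
  proof -
    have "p \<noteq> 0" using that by auto
    \<comment> \<open>The one-sided comparison is applied to \<open>a\<close> and \<open>b i\<close>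
      in both orders.\<close>
    then have "ln (ellipsoid_fun a p) - ln (ellipsoid_fun (b i) p) \<le> 2 * A / (real (i + 2) * T0 i)"
      "ln (ellipsoid_fun (b i) p) - ln (ellipsoid_fun a p) \<le> 2 * A / (real (i + 2) * T0 i)"
      using ab[of _ i] by (intro ellipsoid_fun_ln_diff_le a b; force simp: abs_le_iff)+
    then show ?thesis by (simp add: f_def)
  qed
  have smooth: "smooth_function ?S (f i)" for i
  proof -
    have "smooth_on (- {0}) (f i)"
      unfolding f_def using a b
      by (intro smooth_on_diff smooth_on_ln smooth_on_ellipsoid_fun) (auto intro: ellipsoid_fun_pos)
    then show ?thesis
      unfolding smooth_function_def by (intro ballI exI[of _ "- {0}"] exI[of _ "f i"]) auto
  qed
  have "(\<lambda>i. (SUP p\<in>?S. \<bar>f i p\<bar>) * T i) \<longlonglongrightarrow> 0"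
  proof (rule tendsto_sandwich[OF _ _ tendsto_const])
    have Tpos: "0 < T i" for i using T by (auto simp: periodic_flow_def)
    have ne: "?S \<noteq> {}" by simp
    have "(SUP p\<in>?S. \<bar>f i p\<bar>) \<le> 2 * A / (real (i + 2) * T0 i)" for i
      using bound by (intro cSUP_least ne)
    moreover have nonneg: "0 \<le> (SUP p\<in>?S. \<bar>f i p\<bar>)" for i
    proof -
      obtain p where "p \<in> ?S" using ne by blast
      moreover have "bdd_above ((\<lambda>p. \<bar>f i p\<bar>) ` ?S)"
        using bound by (rule bdd_aboveI2)
      ultimately show ?thesis
        using cSUP_upper2 abs_ge_zero by metis
    qed
    \<comment> \<open>Replacing \<open>T i\<close> by the larger \<open>T0 i\<close> cancels the
      \<open>T0 i\<close> in the norm bound, so no upper bound on the periods is required.\<close>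
    ultimately have "(SUP p\<in>?S. \<bar>f i p\<bar>) * T i \<le> 2 * A / (real (i + 2) * T0 i) * T0 i" for i
      using TT0[of i] Tpos[of i] by (intro mult_mono) (auto intro: order_trans)
    then show "\<forall>\<^sub>F i in sequentially. (SUP p\<in>?S. \<bar>f i p\<bar>) * T i \<le> 2 * A / real (i + 2)"
      using T0 less_irrefl[of "0::real"]
      by (intro always_eventually allI)
        (metis divide_divide_eq_left times_divide_eq_left nonzero_eq_divide_eq)
    show "\<forall>\<^sub>F i in sequentially. 0 \<le> (SUP p\<in>?S. \<bar>f i p\<bar>) * T i"
      using nonneg Tpos by (simp add: less_imp_le)
    show "(\<lambda>i. 2 * A / real (i + 2)) \<longlonglongrightarrow> 0"
      using LIMSEQ_ignore_initial_segment[OF lim_const_over_n[of "2 * A"], of 2] by simp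
  qed
  moreover have "bounded (f i ` ?S)" for i
    using bound by (intro boundedI[of _ "2 * A / (real (i + 2) * T0 i)"]) auto
  moreover have "\<exists>\<Phi>. reeb_flow ?S (ellipsoid_form (b i)) \<Phi> \<and> periodic_flow ?S \<Phi> (T i)" for i
    by (intro exI[of _ "ellipsoid_flow (b i)"] conjI reeb_flow_ellipsoid_flow b T)
  ultimately show ?thesis
    unfolding Hofer_near_periodic_def
    by (intro conjI exI[of _ f] exI[of _ T] allI)
      (simp_all only: form contact_form_ellipsoid_form a b smooth)
qed

theorem lemma5p20:
  fixes a :: "real ^ 'n::{finite, linorder}"
  assumes "\<And>j. 0 < a $ j"
    and "mono (\<lambda>j. a $ j)"
  shows "Hofer_near_periodic (sphere (0 :: complex ^ 'n::{finite, linorder}) 1) std_contact_structure (ellipsoid_form a)"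
  using assms(1) by (rule Hofer_near_periodic_ellipsoid_form)

end
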